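(* For all integers $n\geq 0$ and $k\geq 2$, we have $O_{1,k}(n)=D_{1,k}(n)=E_k(n)$, where: $O_{1,k}(n)$ is the number of partitions of $n$ having exactly one distinct part size divisible by $k$ (that part size possibly repeated); $D_{1,k}(n)$ is the number of partitions of $n$ having exactly one distinct part size that occurs at least $k$ times; and $E_k(n)=A_k(n)-B_k(n)$, where $A_k(n)$ is the total number of parts congruent to $1 \pmod{k}$ (counted with multiplicity), summed over all partitions of $n$ in which no part is divisible by $k$, and $B_k(n)$ is the total number of distinct part sizes, summed over all partitions of $n$ in which no part occurs more than $k-1$ times.
   Context: A partition of a nonnegative integer $n$ is a finite weakly decreasing sequence of positive integers (its parts) summing to $n$; the empty partition is the unique partition of $0$. A partition in which no part is divisible by $k$ is called $k$-regular. The number of distinct part sizes of a partition is the number of distinct values occurring among its parts. *)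

theory Defs
  imports Complex_Main "HOL-Number_Theory.Cong"
begin

definition partitions :: "nat \<Rightarrow> nat list set" where
  "partitions n = {p. sorted_wrt (\<ge>) p \<and> (\<forall>i\<in>set p. i > 0) \<and> sum_list p = n}"

text \<open>Cardinalities of, and sums over, sets of partitions of a fixed number are genuine
  (not the default value 0 for infinite sets).\<close>
lemma finite_partitions: "finite (partitions n)"
proof -
  have len: "length p \<le> sum_list p" if "\<forall>i\<in>set p. i > 0" for p :: "nat list"
    using that by (induction p) auto
  have "partitions n \<subseteq> {p. set p \<subseteq> {..n} \<and> length p \<le> n}"
    unfolding partitions_def using len member_le_sum_list by fastforce
  then show ?thesis
    using finite_lists_length_le[of "{..n}" n] finite_subset by blast
qed

definition part_sizes :: "nat list \<Rightarrow> nat set" where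
  "part_sizes p = set p"

definition regular_partitions :: "nat \<Rightarrow> nat \<Rightarrow> nat list set" where
  "regular_partitions k n = {p \<in> partitions n. \<forall>i\<in>set p. \<not> k dvd i}"

definition O1 :: "nat \<Rightarrow> nat \<Rightarrow> nat" where
  "O1 k n = card {p \<in> partitions n. card {i \<in> part_sizes p. k dvd i} = 1}"

definition D1 :: "nat \<Rightarrow> nat \<Rightarrow> nat" where
  "D1 k n = card {p \<in> partitions n. card {i \<in> part_sizes p. count_list p i \<ge> k} = 1}"

definition A :: "nat \<Rightarrow> nat \<Rightarrow> nat" where
  "A k n = (\<Sum>p\<in>regular_partitions k n. length (filter (\<lambda>i. [i = 1] (mod k)) p))"

definition B :: "nat \<Rightarrow> nat \<Rightarrow> nat" where
  "B k n = (\<Sum>p\<in>{p \<in> partitions n. \<forall>i\<in>set p. count_list p i \<le> k - 1}. card (part_sizes p))"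

definition E :: "nat \<Rightarrow> nat \<Rightarrow> int" where
  "E k n = int (A k n) - int (B k n)"

end

theory Submission
  imports Defs "HOL-Library.Multiset"
begin

text \<open>View partitions as multisets. Every partition splits uniquely as a \<open>k\<close>-regular partition plus
  \<open>k\<close> times the parts of a partition \<open>C\<close>, and also as a partition with all multiplicities below \<open>k\<close>
  plus \<open>k\<close> copies of a partition \<open>C\<close>. Since both decompositions count the same partitions, induction
  on \<open>n\<close> yields Glaisher's theorem, and restricting both to the \<open>C\<close> with a single part size yields
  \<open>O1 = D1\<close>. Furthermore \<open>A\<close> counts the triples of a part \<open>i\<close> congruent to 1 modulo \<open>k\<close>, some
  \<open>r \<ge> 1\<close>, and a \<open>k\<close>-regular partition of \<open>n - i r\<close>. By Glaisher's theorem the last component may be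
  replaced by a partition with multiplicities below \<open>k\<close>; adding \<open>i\<close> copies of \<open>r\<close> to it gives a
  partition in which every size except possibly \<open>r\<close> occurs fewer than \<open>k\<close> times, together with its
  marked part \<open>r\<close>. Those marked partitions are counted by \<open>B + D1\<close>.\<close>

section \<open>Partitions as multisets\<close>

definition mpartitions :: "nat \<Rightarrow> nat multiset set" where
  "mpartitions n = {M. 0 \<notin># M \<and> sum_mset M = n}"

text \<open>A weakly decreasing list is determined by its multiset. The inverse reverses because
  \<open>sorted_list_of_multiset\<close> is increasing.\<close>

lemma bij_betw_mset_partitions: "bij_betw mset (partitions n) (mpartitions n)"
proof (rule bij_betw_byWitness[where f' = "\<lambda>M. rev (sorted_list_of_multiset M)"])
  show "\<forall>p\<in>partitions n. rev (sorted_list_of_multiset (mset p)) = p"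
  proof
    fix p assume "p \<in> partitions n"
    then have "sorted (rev p)"
      by (simp add: partitions_def sorted_wrt_rev)
    then have "sort p = rev p"
      by (intro properties_for_sort) auto
    then show "rev (sorted_list_of_multiset (mset p)) = p"
      by simp
  qed
  show "\<forall>M\<in>mpartitions n. mset (rev (sorted_list_of_multiset M)) = M"
    by simp
  show "mset ` partitions n \<subseteq> mpartitions n"
    by (auto simp: partitions_def mpartitions_def sum_mset_sum_list)
  show "(\<lambda>M. rev (sorted_list_of_multiset M)) ` mpartitions n \<subseteq> partitions n"
  proof clarify
    fix M assume M: "M \<in> mpartitions n"
    have "sum_list (sorted_list_of_multiset M) = sum_mset M"
      by (metis mset_sorted_list_of_multiset sum_mset_sum_list)
    moreover have "sorted (sorted_list_of_multiset M)"
      by (rule sorted_sorted_list_of_multiset)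
    ultimately show "rev (sorted_list_of_multiset M) \<in> partitions n"
      using M by (auto simp: partitions_def mpartitions_def sorted_wrt_rev intro!: gr0I)
  qed
qed

lemma finite_mpartitions [simp]: "finite (mpartitions n)"
  using bij_betw_mset_partitions finite_partitions bij_betw_finite by blast

lemma card_partitions_mset:
  assumes "\<And>p. p \<in> partitions n \<Longrightarrow> P p \<longleftrightarrow> Q (mset p)"
  shows "card {p \<in> partitions n. P p} = card {M \<in> mpartitions n. Q M}"
  using bij_betw_mset_partitions by (intro bij_betw_same_card bij_betw_Collect) (auto simp: assms)

lemma sum_partitions_mset:
  assumes "\<And>p. p \<in> partitions n \<Longrightarrow> P p \<longleftrightarrow> Q (mset p)"
  shows "(\<Sum>p\<in>{p \<in> partitions n. P p}. g (mset p)) = (\<Sum>M\<in>{M \<in> mpartitions n. Q M}. g M)"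
  using bij_betw_mset_partitions
  by (intro sum.reindex_bij_betw bij_betw_Collect) (auto simp: assms)

section \<open>Two decompositions of a partition\<close>

definition regular :: "nat \<Rightarrow> nat multiset \<Rightarrow> bool" where
  "regular k M \<longleftrightarrow> (\<forall>i\<in>#M. \<not> k dvd i)"

definition sparse :: "nat \<Rightarrow> nat multiset \<Rightarrow> bool" where
  "sparse k M \<longleftrightarrow> (\<forall>i. count M i < k)"

definition div_parts :: "nat \<Rightarrow> nat multiset \<Rightarrow> nat multiset" where
  "div_parts k M = image_mset (\<lambda>i. i div k) {#i \<in># M. k dvd i#}"

definition div_mset :: "nat \<Rightarrow> 'a multiset \<Rightarrow> 'a multiset" where
  "div_mset k M = Abs_multiset (\<lambda>i. count M i div k)"

definition mod_mset :: "nat \<Rightarrow> 'a multiset \<Rightarrow> 'a multiset" where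
  "mod_mset k M = Abs_multiset (\<lambda>i. count M i mod k)"

lemma count_div_mset [simp]: "count (div_mset k M) i = count M i div k"
proof -
  \<comment> \<open>\<open>Abs_multiset\<close> is faithful only on functions of finite support;
    here the support lies inside that of \<open>M\<close>.\<close>
  have "finite {i. 0 < count M i div k}"
    by (rule finite_subset[OF _ finite_set_mset[of M]]) (auto simp: div_greater_zero_iff simp flip: count_greater_zero_iff)
  then show ?thesis
    by (simp add: div_mset_def)
qed

lemma count_mod_mset [simp]: "count (mod_mset k M) i = count M i mod k"
proof -
  have "finite {i. 0 < count M i mod k}"
    by (rule finite_subset[OF _ finite_set_mset[of M]]) (auto intro!: gr0I simp flip: count_greater_zero_iff)
  then show ?thesis
    by (simp add: mod_mset_def)
qed

lemma sum_repeat_mset: "sum_mset (repeat_mset k M) = k * sum_mset (M :: nat multiset)"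
  by (induction k) (auto simp: algebra_simps)

lemma sum_image_mult_mset: "sum_mset (image_mset ((*) k) M) = k * sum_mset (M :: nat multiset)"
  by (induction M) (auto simp: algebra_simps)

text \<open>The parts divisible by \<open>k\<close> form \<open>k\<close> times \<open>C\<close>,
  the others form \<open>D\<close>. The predicate \<open>Q\<close> is left free so that the same
  bijection serves all partitions and those whose \<open>C\<close> has one part size. The bound
  \<open>k * sum_mset C \<le> n\<close> keeps the natural-number subtraction genuine.\<close>

lemma bij_betw_regular_decomposition:
  assumes "k > 0"
  shows "bij_betw (\<lambda>(C, D). D + image_mset ((*) k) C)
    (SIGMA C:{C. 0 \<notin># C \<and> Q C \<and> k * sum_mset C \<le> n}.
      {D \<in> mpartitions (n - k * sum_mset C). regular k D})
    {M \<in> mpartitions n. Q (div_parts k M)}"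
proof (rule bij_betw_byWitness[where f' = "\<lambda>M. (div_parts k M, {#i \<in># M. \<not> k dvd i#})"])
  have inverse: "div_parts k (D + image_mset ((*) k) C) = C"
    "{#i \<in># D + image_mset ((*) k) C. \<not> k dvd i#} = D" if "regular k D" for C D
  proof -
    have "{#i \<in># D. k dvd i#} = {#}" "{#i \<in># D. \<not> k dvd i#} = D"
      using that by (auto simp: regular_def filter_mset_eq_conv)
    then show "div_parts k (D + image_mset ((*) k) C) = C"
      "{#i \<in># D + image_mset ((*) k) C. \<not> k dvd i#} = D"
      using assms by (simp_all add: div_parts_def filter_mset_image_mset image_mset.compositionality comp_def)
  qed
  have decomposition: "{#i \<in># M. \<not> k dvd i#} + image_mset ((*) k) (div_parts k M) = M" for M
  proof -
    have "image_mset ((*) k) (div_parts k M) = image_mset id {#i \<in># M. k dvd i#}"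
      unfolding div_parts_def image_mset.compositionality
      by (intro image_mset_cong) auto
    then show ?thesis
      by (simp add: multiset_partition[symmetric] add.commute)
  qed
  show "\<forall>a\<in>SIGMA C:{C. 0 \<notin># C \<and> Q C \<and> k * sum_mset C \<le> n}.
      {D \<in> mpartitions (n - k * sum_mset C). regular k D}.
    (div_parts k (case a of (C, D) \<Rightarrow> D + image_mset ((*) k) C),
      {#i \<in># case a of (C, D) \<Rightarrow> D + image_mset ((*) k) C. \<not> k dvd i#}) = a"
    using inverse by auto
  show "\<forall>M\<in>{M \<in> mpartitions n. Q (div_parts k M)}.
    (case (div_parts k M, {#i \<in># M. \<not> k dvd i#}) of (C, D) \<Rightarrow> D + image_mset ((*) k) C) = M"
    using decomposition by simp
  show "(\<lambda>(C, D). D + image_mset ((*) k) C) `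
    (SIGMA C:{C. 0 \<notin># C \<and> Q C \<and> k * sum_mset C \<le> n}.
      {D \<in> mpartitions (n - k * sum_mset C). regular k D})
    \<subseteq> {M \<in> mpartitions n. Q (div_parts k M)}"
    using assms by (auto simp: mpartitions_def inverse sum_image_mult_mset)
  show "(\<lambda>M. (div_parts k M, {#i \<in># M. \<not> k dvd i#})) ` {M \<in> mpartitions n. Q (div_parts k M)}
    \<subseteq> (SIGMA C:{C. 0 \<notin># C \<and> Q C \<and> k * sum_mset C \<le> n}.
      {D \<in> mpartitions (n - k * sum_mset C). regular k D})"
  proof clarify
    fix M assume M: "M \<in> mpartitions n" "Q (div_parts k M)"
    have "sum_mset {#i \<in># M. \<not> k dvd i#} + k * sum_mset (div_parts k M) = n"
      using M arg_cong[OF decomposition[of M], of sum_mset]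
      by (simp add: mpartitions_def sum_image_mult_mset)
    moreover have "0 \<notin># div_parts k M"
      using M assms by (auto simp: div_parts_def mpartitions_def)
    ultimately show "div_parts k M \<in> {C. 0 \<notin># C \<and> Q C \<and> k * sum_mset C \<le> n} \<and>
      {#i \<in># M. \<not> k dvd i#} \<in> {D \<in> mpartitions (n - k * sum_mset (div_parts k M)). regular k D}"
      using M by (auto simp: mpartitions_def regular_def)
  qed
qed

text \<open>Euclidean division of every multiplicity by \<open>k\<close>: the quotients give
  \<open>C\<close>, the remainders \<open>D\<close>. The index set of the \<open>C\<close> is the
  same as for the regular decomposition, so the two can be compared fibre by fibre.\<close>

lemma bij_betw_sparse_decomposition:
  assumes "k > 0"
  shows "bij_betw (\<lambda>(C, D). D + repeat_mset k C)
    (SIGMA C:{C. 0 \<notin># C \<and> Q C \<and> k * sum_mset C \<le> n}.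
      {D \<in> mpartitions (n - k * sum_mset C). sparse k D})
    {M \<in> mpartitions n. Q (div_mset k M)}"
proof (rule bij_betw_byWitness[where f' = "\<lambda>M. (div_mset k M, mod_mset k M)"])
  have inverse: "div_mset k (D + repeat_mset k C) = C" "mod_mset k (D + repeat_mset k C) = D"
    if "sparse k D" for C D
    using that assms by (auto simp: sparse_def multiset_eq_iff)
  have decomposition: "mod_mset k M + repeat_mset k (div_mset k M) = M" for M :: "nat multiset"
    by (simp add: multiset_eq_iff)
  show "\<forall>a\<in>SIGMA C:{C. 0 \<notin># C \<and> Q C \<and> k * sum_mset C \<le> n}.
      {D \<in> mpartitions (n - k * sum_mset C). sparse k D}.
    (div_mset k (case a of (C, D) \<Rightarrow> D + repeat_mset k C),
      mod_mset k (case a of (C, D) \<Rightarrow> D + repeat_mset k C)) = a"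
    using inverse by auto
  show "\<forall>M\<in>{M \<in> mpartitions n. Q (div_mset k M)}.
    (case (div_mset k M, mod_mset k M) of (C, D) \<Rightarrow> D + repeat_mset k C) = M"
    using decomposition by simp
  show "(\<lambda>(C, D). D + repeat_mset k C) `
    (SIGMA C:{C. 0 \<notin># C \<and> Q C \<and> k * sum_mset C \<le> n}.
      {D \<in> mpartitions (n - k * sum_mset C). sparse k D})
    \<subseteq> {M \<in> mpartitions n. Q (div_mset k M)}"
    using assms by (auto simp: mpartitions_def inverse sum_repeat_mset not_in_iff)
  show "(\<lambda>M. (div_mset k M, mod_mset k M)) ` {M \<in> mpartitions n. Q (div_mset k M)}
    \<subseteq> (SIGMA C:{C. 0 \<notin># C \<and> Q C \<and> k * sum_mset C \<le> n}.
      {D \<in> mpartitions (n - k * sum_mset C). sparse k D})"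
  proof clarify
    fix M assume M: "M \<in> mpartitions n" "Q (div_mset k M)"
    have "sum_mset (mod_mset k M) + k * sum_mset (div_mset k M) = n"
      using M arg_cong[OF decomposition[of M], of sum_mset]
      by (simp add: mpartitions_def sum_repeat_mset)
    moreover have "0 \<notin># div_mset k M" "0 \<notin># mod_mset k M"
      using M by (auto simp: mpartitions_def not_in_iff)
    ultimately show "div_mset k M \<in> {C. 0 \<notin># C \<and> Q C \<and> k * sum_mset C \<le> n} \<and>
      mod_mset k M \<in> {D \<in> mpartitions (n - k * sum_mset (div_mset k M)). sparse k D}"
      using M assms by (auto simp: mpartitions_def sparse_def)
  qed
qed

section \<open>Glaisher's theorem and its refinement\<close>

lemma finite_bounded_mpartitions:
  assumes "(k :: nat) > 0"
  shows "finite {C. 0 \<notin># C \<and> Q C \<and> k * sum_mset C \<le> n}"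
proof (rule finite_subset)
  show "{C. 0 \<notin># C \<and> Q C \<and> k * sum_mset C \<le> n} \<subseteq> (\<Union>c\<le>n. mpartitions c)"
  proof
    fix C assume C: "C \<in> {C. 0 \<notin># C \<and> Q C \<and> k * sum_mset C \<le> n}"
    have "sum_mset C \<le> k * sum_mset C"
      using assms by simp
    with C have "sum_mset C \<le> n" "0 \<notin># C"
      by (blast intro: le_trans)+
    then show "C \<in> (\<Union>c\<le>n. mpartitions c)"
      by (simp add: mpartitions_def)
  qed
qed simp

text \<open>Both decompositions express the number of partitions of \<open>n\<close> as a sum over
  \<open>C\<close>. By induction the terms with \<open>C\<close> nonempty agree, so the terms for
  the empty \<open>C\<close>, which are the two sides of the claim, agree as well.\<close>

lemma glaisher:
  assumes "k > 0"
  shows "card {D \<in> mpartitions n. regular k D} = card {D \<in> mpartitions n. sparse k D}"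
proof (induction n rule: less_induct)
  case (less n)
  \<comment> \<open>The conjunct \<open>True\<close> is the trivial \<open>Q\<close>; it keeps the
    set in the form of the lemmas above.\<close>
  define I where "I = {C. 0 \<notin># C \<and> True \<and> k * sum_mset C \<le> n}"
  define r where "r C = card {D \<in> mpartitions (n - k * sum_mset C). regular k D}" for C
  define d where "d C = card {D \<in> mpartitions (n - k * sum_mset C). sparse k D}" for C
  have fin: "finite I"
    unfolding I_def using assms by (rule finite_bounded_mpartitions)
  have "sum r I = sum d I"
    using bij_betw_same_card[OF bij_betw_regular_decomposition[OF assms, of "\<lambda>_. True" n]]
      bij_betw_same_card[OF bij_betw_sparse_decomposition[OF assms, of "\<lambda>_. True" n]] fin
    by (simp add: I_def r_def d_def)
  moreover have empty: "{#} \<in> I"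
    by (simp add: I_def)
  moreover have "sum r (I - {{#}}) = sum d (I - {{#}})"
  proof (rule sum.cong)
    fix C assume C: "C \<in> I - {{#}}"
    then obtain i where "i \<in># C" "i \<noteq> 0"
      unfolding I_def by (cases C) auto
    then have "sum_mset C \<noteq> 0"
      by auto
    \<comment> \<open>Strictness also needs \<open>n > 0\<close>, which follows from
      \<open>k * sum_mset C \<le> n\<close>.\<close>
    with C assms have "n - k * sum_mset C < n"
      by (auto simp: I_def intro!: diff_less gr0I)
    then show "r C = d C"
      unfolding r_def d_def by (rule less.IH)
  qed simp
  ultimately have "r {#} = d {#}"
    using fin by (simp add: sum.remove)
  then show ?case
    by (simp add: r_def d_def)
qed

text \<open>For each \<open>C\<close> satisfying \<open>Q\<close>, Glaisher's theorem says that the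
  two fibres over \<open>C\<close> have the same size.\<close>

lemma card_div_parts_eq_card_div_mset:
  assumes "k > 0"
  shows "card {M \<in> mpartitions n. Q (div_parts k M)} = card {M \<in> mpartitions n. Q (div_mset k M)}"
  using bij_betw_same_card[OF bij_betw_regular_decomposition[OF assms, of Q n]]
    bij_betw_same_card[OF bij_betw_sparse_decomposition[OF assms, of Q n]]
    finite_bounded_mpartitions[OF assms, of Q n]
  by (simp add: glaisher[OF assms])

section \<open>The equality of \<open>O1\<close> and \<open>D1\<close>\<close>

lemma D1_eq:
  assumes "k > 0"
  shows "D1 k n = card {M \<in> mpartitions n. card (set_mset (div_mset k M)) = 1}"
  unfolding D1_def
proof (rule card_partitions_mset)
  fix p
  have "set_mset (div_mset k (mset p)) = {i \<in> part_sizes p. k \<le> count_list p i}"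
  proof (rule set_eqI)
    fix i
    have "i \<in># div_mset k (mset p) \<longleftrightarrow> count (mset p) i div k > 0"
      unfolding count_greater_zero_iff[symmetric] by simp
    also have "\<dots> \<longleftrightarrow> k \<le> count_list p i"
      using assms by (simp add: div_greater_zero_iff count_mset)
    also have "\<dots> \<longleftrightarrow> i \<in> {i \<in> part_sizes p. k \<le> count_list p i}"
      using assms count_list_0_iff[of p i] by (auto simp: part_sizes_def)
    finally show "i \<in># div_mset k (mset p) \<longleftrightarrow> i \<in> {i \<in> part_sizes p. k \<le> count_list p i}" .
  qed
  then show "card {i \<in> part_sizes p. k \<le> count_list p i} = 1 \<longleftrightarrow>
    card (set_mset (div_mset k (mset p))) = 1"
    by simp
qed

text \<open>Division by \<open>k\<close> is injective on multiples of \<open>k\<close>, so the sizes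
  divisible by \<open>k\<close> correspond to the sizes in \<open>div_parts\<close>.\<close>

lemma O1_eq:
  assumes "k > 0"
  shows "O1 k n = card {M \<in> mpartitions n. card (set_mset (div_parts k M)) = 1}"
  unfolding O1_def
proof (rule card_partitions_mset)
  fix p
  have "set_mset (div_parts k (mset p)) = (\<lambda>i. i div k) ` {i \<in> part_sizes p. k dvd i}"
    by (simp add: div_parts_def part_sizes_def)
  moreover have "inj_on (\<lambda>i. i div k) {i \<in> part_sizes p. k dvd i}"
    using assms by (auto simp: inj_on_def)
  ultimately show "card {i \<in> part_sizes p. k dvd i} = 1 \<longleftrightarrow>
    card (set_mset (div_parts k (mset p))) = 1"
    by (simp add: card_image)
qed

lemma O1_eq_D1:
  assumes "k > 0"
  shows "O1 k n = D1 k n"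
  unfolding O1_eq[OF assms] D1_eq[OF assms] using assms by (rule card_div_parts_eq_card_div_mset)

section \<open>The identity \<open>A = B + D1\<close>\<close>

definition index_pairs :: "nat \<Rightarrow> nat \<Rightarrow> (nat \<times> nat) set" where
  "index_pairs k n = {(i, r). [i = 1] (mod k) \<and> 0 < i \<and> 0 < r \<and> i * r \<le> n}"

lemma finite_index_pairs [simp]: "finite (index_pairs k n)"
proof (rule finite_subset)
  show "index_pairs k n \<subseteq> {..n} \<times> {..n}"
  proof clarify
    fix i r assume "(i, r) \<in> index_pairs k n"
    then have "0 < i" "0 < r" "i * r \<le> n"
      by (auto simp: index_pairs_def)
    moreover from this have "i * 1 \<le> i * r" "1 * r \<le> i * r"
      by (auto intro!: mult_le_mono)
    ultimately have "i \<le> n" "r \<le> n"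
      by linarith+
    then show "i \<in> {..n} \<and> r \<in> {..n}"
      by simp
  qed
qed simp

text \<open>A size \<open>i\<close> of multiplicity \<open>c\<close> contributes \<open>c\<close> to
  the count, recorded by a number \<open>r\<close> from 1 to \<open>c\<close>. Removing
  \<open>r\<close> copies of \<open>i\<close> leaves a regular partition of
  \<open>n - i * r\<close>, and this can be undone.\<close>

lemma A_eq:
  assumes "k \<ge> 2"
  shows "A k n = card (SIGMA (i, r):index_pairs k n. {D \<in> mpartitions (n - i * r). regular k D})"
proof -
  let ?S = "SIGMA M:{M \<in> mpartitions n. regular k M}. SIGMA i:{i \<in> set_mset M. [i = 1] (mod k)}. {1..count M i}"
  have "A k n = (\<Sum>p\<in>{p \<in> partitions n. \<forall>i\<in>set p. \<not> k dvd i}. size {#i \<in># mset p. [i = 1] (mod k)#})"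
    by (simp add: A_def regular_partitions_def flip: mset_filter)
  also have "\<dots> = (\<Sum>M\<in>{M \<in> mpartitions n. regular k M}. size {#i \<in># M. [i = 1] (mod k)#})"
    by (rule sum_partitions_mset) (simp add: regular_def)
  also have "\<dots> = (\<Sum>M\<in>{M \<in> mpartitions n. regular k M}. \<Sum>i\<in>{i \<in> set_mset M. [i = 1] (mod k)}. count M i)"
    by (intro sum.cong) (auto simp: size_multiset_overloaded_eq)
  also have "\<dots> = card ?S"
    by simp
  finally have A: "A k n = card ?S" .
  have "bij_betw (\<lambda>(M, i, r). ((i, r), M - replicate_mset r i)) ?S
    (SIGMA (i, r):index_pairs k n. {D \<in> mpartitions (n - i * r). regular k D})"
  proof (rule bij_betw_byWitness[where f' = "\<lambda>((i, r), D :: nat multiset). (D + replicate_mset r i, i, r)"])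
    show "\<forall>a\<in>?S. (\<lambda>((i, r), D). (D + replicate_mset r i, i, r))
        ((\<lambda>(M, i, r). ((i, r), M - replicate_mset r i)) a) = a"
      by (auto simp: subset_mset.diff_add simp flip: count_le_replicate_mset_subset_eq)
    show "\<forall>a\<in>SIGMA (i, r):index_pairs k n. {D \<in> mpartitions (n - i * r). regular k D}.
      (\<lambda>(M, i, r). ((i, r), M - replicate_mset r i))
        ((\<lambda>((i, r), D). (D + replicate_mset r i, i, r)) a) = a"
      by auto
    show "(\<lambda>(M, i, r). ((i, r), M - replicate_mset r i)) ` ?S
      \<subseteq> (SIGMA (i, r):index_pairs k n. {D \<in> mpartitions (n - i * r). regular k D})"
    proof (rule image_subsetI)
      fix x assume "x \<in> ?S"
      then obtain M i r where x: "x = (M, i, r)" and M: "M \<in> mpartitions n" "regular k M"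
        and i: "i \<in># M" "[i = 1] (mod k)" and r: "r \<in> {1..count M i}"
        by auto
      have sub: "replicate_mset r i \<subseteq># M"
        using r by (simp flip: count_le_replicate_mset_subset_eq)
      then have "sum_mset M = sum_mset (M - replicate_mset r i) + r * i"
        by (metis subset_mset.diff_add sum_mset.union sum_mset_replicate_mset of_nat_id)
      with M i r show "(\<lambda>(M, i, r). ((i, r), M - replicate_mset r i)) x \<in>
        (SIGMA (i, r):index_pairs k n. {D \<in> mpartitions (n - i * r). regular k D})"
        unfolding x by (auto simp: mpartitions_def regular_def index_pairs_def mult.commute intro!: gr0I dest: in_diffD)
    qed
    show "(\<lambda>((i, r), D). (D + replicate_mset r i, i, r)) `
      (SIGMA (i, r):index_pairs k n. {D \<in> mpartitions (n - i * r). regular k D}) \<subseteq> ?S"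
    proof (rule image_subsetI)
      fix x assume "x \<in> (SIGMA (i, r):index_pairs k n. {D \<in> mpartitions (n - i * r). regular k D})"
      then obtain i r D where x: "x = ((i, r), D)" and i: "(i, r) \<in> index_pairs k n"
        and D: "D \<in> mpartitions (n - i * r)" "regular k D"
        by auto
      \<comment> \<open>Putting the copies of \<open>i\<close> back preserves regularity: as
        \<open>k \<ge> 2\<close>, no number congruent to 1 is a multiple of
        \<open>k\<close>.\<close>
      have "\<not> k dvd i"
        using i assms by (auto simp: index_pairs_def cong_def dvd_eq_mod_eq_0)
      with i D show "(\<lambda>((i, r), D). (D + replicate_mset r i, i, r)) x \<in> ?S"
        unfolding x by (auto simp: mpartitions_def regular_def index_pairs_def mult.commute split: if_splits)
    qed
  qed
  then show ?thesis
    unfolding A by (rule bij_betw_same_card)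
qed

text \<open>Split by the multiplicity of the marked size \<open>j\<close>. If it is below
  \<open>k\<close>, the partition is sparse with an arbitrary mark, as counted by \<open>B\<close>.
  Otherwise \<open>j\<close> is the unique size occurring at least \<open>k\<close> times, as in
  \<open>D1\<close>.\<close>

lemma B_plus_D1_eq:
  assumes "k > 0"
  shows "B k n + D1 k n = card {(M, j). M \<in> mpartitions n \<and> j \<in># M \<and> (\<forall>i. i \<noteq> j \<longrightarrow> count M i < k)}"
proof -
  let ?S = "SIGMA M:{M \<in> mpartitions n. sparse k M}. set_mset M"
  let ?T = "{(M, j). M \<in> mpartitions n \<and> k \<le> count M j \<and> (\<forall>i. i \<noteq> j \<longrightarrow> count M i < k)}"
  let ?U = "{(M, j). M \<in> mpartitions n \<and> j \<in># M \<and> (\<forall>i. i \<noteq> j \<longrightarrow> count M i < k)}"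
  have "B k n = (\<Sum>p\<in>{p \<in> partitions n. \<forall>i\<in>set p. count_list p i \<le> k - 1}. card (set_mset (mset p)))"
    by (simp add: B_def part_sizes_def)
  also have "\<dots> = (\<Sum>M\<in>{M \<in> mpartitions n. sparse k M}. card (set_mset M))"
  proof (rule sum_partitions_mset)
    fix p :: "nat list"
    \<comment> \<open>\<open>sparse\<close> ranges over all numbers, \<open>B\<close> only over
      actual parts; absent numbers have multiplicity 0, which is below \<open>k\<close>.\<close>
    have "count_list p i < k" if "i \<notin> set p" for i
      using that assms by (simp add: count_list_0_iff)
    then show "(\<forall>i\<in>set p. count_list p i \<le> k - 1) \<longleftrightarrow> sparse k (mset p)"
      using assms by (auto simp: sparse_def count_mset less_eq_iff_succ_less le_diff_conv2)
  qed
  also have "\<dots> = card ?S"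
    by simp
  finally have B: "B k n = card ?S" .
  \<comment> \<open>In \<open>?T\<close> the mark is determined by the partition, so forgetting it
    loses nothing.\<close>
  have "fst ` ?T = {M \<in> mpartitions n. card (set_mset (div_mset k M)) = 1}"
  proof -
    have "set_mset (div_mset k M) = {j. k \<le> count M j}" for M :: "nat multiset"
      using assms by (auto simp: div_greater_zero_iff simp flip: count_greater_zero_iff)
    moreover have "{j. k \<le> count M j} = {j} \<longleftrightarrow> k \<le> count M j \<and> (\<forall>i. i \<noteq> j \<longrightarrow> count M i < k)"
      for M :: "nat multiset" and j
      by (auto simp: not_le[symmetric])
    ultimately have "card (set_mset (div_mset k M)) = 1 \<longleftrightarrow>
      (\<exists>j. k \<le> count M j \<and> (\<forall>i. i \<noteq> j \<longrightarrow> count M i < k))" for M :: "nat multiset"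
      unfolding One_nat_def card_1_singleton_iff by simp
    then show ?thesis
      unfolding image_def by auto
  qed
  moreover have "inj_on fst ?T"
    by (auto simp: inj_on_def not_le[symmetric])
  ultimately have D1: "D1 k n = card ?T"
    unfolding D1_eq[OF assms] by (metis (no_types, lifting) card_image)
  have "?U = ?S \<union> ?T"
  proof -
    have "(M, j) \<in> ?U \<longleftrightarrow> (M, j) \<in> ?S \<union> ?T" for M j
    proof -
      have "sparse k M \<longleftrightarrow> count M j < k \<and> (\<forall>i. i \<noteq> j \<longrightarrow> count M i < k)"
        unfolding sparse_def by metis
      moreover have "j \<in># M" if "k \<le> count M j"
        using assms that by (simp flip: count_greater_zero_iff)
      ultimately show ?thesis
        by (cases "count M j < k") auto
    qed
    then show ?thesis
      by (intro set_eqI) (simp only: split_paired_all)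
  qed
  moreover have "?S \<inter> ?T = {}"
    by (auto simp: sparse_def not_le[symmetric])
  moreover have "finite ?S"
    by simp
  moreover have "finite ?T"
    by (rule finite_subset[of _ "SIGMA M:mpartitions n. set_mset M"])
      (use assms in \<open>auto simp flip: count_greater_zero_iff\<close>)
  ultimately show ?thesis
    unfolding B D1 by (simp add: card_Un_disjoint)
qed

text \<open>The roles of \<open>i\<close> and \<open>r\<close> are exchanged compared with
  \<open>A_eq\<close>: \<open>i\<close> copies of the size \<open>r\<close> are added to
  \<open>D\<close> and \<open>r\<close> is marked. Conversely, if the marked size has multiplicity
  \<open>c\<close>, then exactly one positive \<open>i\<close> congruent to 1 satisfies
  \<open>i \<le> c < i + k\<close>, so \<open>i\<close> and \<open>D\<close> can be
  recovered.\<close>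

lemma card_marked_sparse:
  assumes "k \<ge> 2"
  shows "card {(M, j). M \<in> mpartitions n \<and> j \<in># M \<and> (\<forall>i. i \<noteq> j \<longrightarrow> count M i < k)} =
    card (SIGMA (i, r):index_pairs k n. {D \<in> mpartitions (n - i * r). sparse k D})"
proof -
  \<comment> \<open>the largest number congruent to 1 modulo \<open>k\<close> that is at most \<open>count M j\<close>\<close>
  define s where "s M j = Suc (k * ((count M j - 1) div k))" for M :: "nat multiset" and j
  let ?U = "{(M, j). M \<in> mpartitions n \<and> j \<in># M \<and> (\<forall>i. i \<noteq> j \<longrightarrow> count M i < k)}"
  let ?V = "SIGMA (i, r):index_pairs k n. {D \<in> mpartitions (n - i * r). sparse k D}"
  \<comment> \<open>If \<open>i = k * m + 1\<close> and \<open>D\<close> has \<open>d < k\<close>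
    copies of \<open>r\<close>, the multiplicity minus 1 is \<open>k * m + d\<close>, whose quotient
    by \<open>k\<close> is \<open>m\<close>.\<close>
  have s_add: "s (D + replicate_mset i r) r = i" if "[i = 1] (mod k)" "0 < i" "sparse k D" for i r D
  proof -
    have "k dvd i - 1"
      using that by (simp add: cong_altdef_nat cong_sym)
    then obtain m where "i - 1 = k * m" ..
    with that have "i = Suc (k * m)"
      by simp
    with that assms show ?thesis
      by (simp add: s_def sparse_def)
  qed
  have split: "s M j \<le> count M j" "count M j - s M j < k" if "j \<in># M" for M j
  proof -
    \<comment> \<open>As \<open>j\<close> occurs in \<open>M\<close>, subtracting 1 is genuine; what
      exceeds \<open>s M j\<close> is exactly the remainder.\<close>
    have "count M j = Suc (k * ((count M j - 1) div k) + (count M j - 1) mod k)"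
      using that by simp
    moreover have "(count M j - 1) mod k < k"
      using assms by simp
    ultimately show "s M j \<le> count M j" "count M j - s M j < k"
      unfolding s_def by linarith+
  qed
  have "bij_betw (\<lambda>(M, j). ((s M j, j), M - replicate_mset (s M j) j)) ?U ?V"
  proof (rule bij_betw_byWitness[where f' = "\<lambda>((i, r), D :: nat multiset). (D + replicate_mset i r, r)"])
    show "\<forall>a\<in>?U. (\<lambda>((i, r), D). (D + replicate_mset i r, r))
        ((\<lambda>(M, j). ((s M j, j), M - replicate_mset (s M j) j)) a) = a"
      using split(1) by (auto simp: subset_mset.diff_add simp flip: count_le_replicate_mset_subset_eq)
    show "\<forall>a\<in>?V. (\<lambda>(M, j). ((s M j, j), M - replicate_mset (s M j) j))
        ((\<lambda>((i, r), D). (D + replicate_mset i r, r)) a) = a"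
      by (auto simp: index_pairs_def s_add)
    show "(\<lambda>(M, j). ((s M j, j), M - replicate_mset (s M j) j)) ` ?U \<subseteq> ?V"
    proof (rule image_subsetI)
      fix x assume "x \<in> ?U"
      then obtain M j where x: "x = (M, j)" and M: "M \<in> mpartitions n" and j: "j \<in># M"
        and other: "\<forall>i. i \<noteq> j \<longrightarrow> count M i < k"
        by auto
      have "replicate_mset (s M j) j \<subseteq># M"
        using split(1)[OF j] by (simp flip: count_le_replicate_mset_subset_eq)
      then have "sum_mset M = sum_mset (M - replicate_mset (s M j) j) + s M j * j"
        by (metis subset_mset.diff_add sum_mset.union sum_mset_replicate_mset of_nat_id)
      moreover have "sparse k (M - replicate_mset (s M j) j)"
        using other split(2)[OF j] by (auto simp: sparse_def)
      moreover have "[s M j = 1] (mod k)"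
        unfolding s_def cong_def Suc_eq_plus1_left by (rule mod_mult_self2)
      moreover have "0 < s M j"
        by (simp add: s_def)
      ultimately show "(\<lambda>(M, j). ((s M j, j), M - replicate_mset (s M j) j)) x \<in> ?V"
        unfolding x using M j by (auto simp: mpartitions_def index_pairs_def intro!: gr0I dest: in_diffD)
    qed
    show "(\<lambda>((i, r), D). (D + replicate_mset i r, r)) ` ?V \<subseteq> ?U"
      by (auto simp: mpartitions_def sparse_def index_pairs_def split: if_splits)
  qed
  then show ?thesis
    by (rule bij_betw_same_card)
qed

theorem theorem1p5:
  fixes n k :: nat
  assumes "k \<ge> 2"
  shows "O1 k n = D1 k n \<and> int (D1 k n) = E k n"
proof -
  have k: "k > 0"
    using assms by simp
  \<comment> \<open>Both sides are sums over the same pairs \<open>(i, r)\<close>, and Glaisher's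
    theorem for \<open>n - i * r\<close> equates the terms.\<close>
  have "A k n = B k n + D1 k n"
    unfolding A_eq[OF assms] B_plus_D1_eq[OF k] card_marked_sparse[OF assms]
    by (subst (1 2) card_SigmaI) (auto simp: glaisher[OF k] intro!: sum.cong)
  then show ?thesis
    by (simp add: E_def O1_eq_D1[OF k])
qed

end
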